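(* Define rooted trees $T_n$, $n\ge 2$, as follows: $T_2$ is the star on $17$ vertices rooted at its center; for $n>2$, $T_n$ consists of a root $r$ with $16n+1$ children, each child being adjacent to the root of its own copy of $T_{n-1}$ (all copies disjoint). Then for every $n\ge 2$, every unit grid intersection representation of $T_n$ has boundary size at least $n$, where the boundary size is the semiperimeter (half the perimeter) of the smallest axis-parallel rectangle containing all segments of the representation.
   Context: A unit grid intersection representation of a bipartite graph $G$ with bipartition $(H,V)$ assigns to each vertex of $H$ a horizontal closed line segment of length $1$ and to each vertex of $V$ a vertical closed line segment of length $1$ in the plane, such that no two horizontal segments intersect, no two vertical segments intersect, and for $u\in H$, $v\in V$ the segments of $u$ and $v$ intersect if and only if $uv\in E(G)$. *)

theory Defs
  imports "HOL-Analysis.Analysis"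
begin

datatype rtree = Node "rtree list"

text \<open>
  Vertices of a rooted tree are addressed by the path of child indices leading to them from the
  root, so distinct copies of a subtree have disjoint vertex sets.
\<close>

primrec tree_verts :: "rtree \<Rightarrow> nat list set" where
  "tree_verts (Node ts) = insert [] (\<Union>i<length ts. (#) i ` (map tree_verts ts ! i))"

definition tree_edges :: "rtree \<Rightarrow> nat list set set" where
  "tree_edges t = {{p, p @ [i]} | p i. p @ [i] \<in> tree_verts t}"

text \<open>The trees are only meaningful for \<open>n \<ge> 2\<close>; smaller indices get a dummy value.\<close>

fun T :: "nat \<Rightarrow> rtree" where
  "T n = (if n \<le> 2 then Node (replicate 16 (Node []))
          else Node (replicate (16 * n + 1) (Node [T (n - 1)])))"

declare T.simps [simp del]

definition bipartition :: "'a set \<Rightarrow> 'a set set \<Rightarrow> 'a set \<Rightarrow> 'a set \<Rightarrow> bool" where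
  "bipartition W E H V \<longleftrightarrow>
     H \<union> V = W \<and> H \<inter> V = {} \<and> (\<forall>e\<in>E. \<exists>u\<in>H. \<exists>v\<in>V. e = {u, v})"

definition horizontal_unit_segment :: "(real \<times> real) set \<Rightarrow> bool" where
  "horizontal_unit_segment s \<longleftrightarrow> (\<exists>x y. s = closed_segment (x, y) (x + 1, y))"

definition vertical_unit_segment :: "(real \<times> real) set \<Rightarrow> bool" where
  "vertical_unit_segment s \<longleftrightarrow> (\<exists>x y. s = closed_segment (x, y) (x, y + 1))"

definition unit_grid_representation ::
    "'a set \<Rightarrow> 'a set set \<Rightarrow> 'a set \<Rightarrow> 'a set \<Rightarrow> ('a \<Rightarrow> (real \<times> real) set) \<Rightarrow> bool" where
  "unit_grid_representation W E H V S \<longleftrightarrow>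
     bipartition W E H V \<and>
     (\<forall>u\<in>H. horizontal_unit_segment (S u)) \<and>
     (\<forall>v\<in>V. vertical_unit_segment (S v)) \<and>
     (\<forall>u\<in>H. \<forall>u'\<in>H. u \<noteq> u' \<longrightarrow> S u \<inter> S u' = {}) \<and>
     (\<forall>v\<in>V. \<forall>v'\<in>V. v \<noteq> v' \<longrightarrow> S v \<inter> S v' = {}) \<and>
     (\<forall>u\<in>H. \<forall>v\<in>V. S u \<inter> S v \<noteq> {} \<longleftrightarrow> {u, v} \<in> E)"

definition axis_parallel_rectangle :: "(real \<times> real) set \<Rightarrow> bool" where
  "axis_parallel_rectangle R \<longleftrightarrow> (\<exists>a b c d. a \<le> b \<and> c \<le> d \<and> R = {a..b} \<times> {c..d})"

text \<open>The smallest rectangle is the least one with respect to inclusion.\<close>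

definition bounding_box :: "(real \<times> real) set \<Rightarrow> (real \<times> real) set" where
  "bounding_box A = (LEAST R. axis_parallel_rectangle R \<and> A \<subseteq> R)"

definition semiperimeter :: "(real \<times> real) set \<Rightarrow> real" where
  "semiperimeter R = (Sup (fst ` R) - Inf (fst ` R)) + (Sup (snd ` R) - Inf (snd ` R))"

definition boundary_size :: "'a set \<Rightarrow> ('a \<Rightarrow> (real \<times> real) set) \<Rightarrow> real" where
  "boundary_size W S = semiperimeter (bounding_box (\<Union>w\<in>W. S w))"

lemma semiperimeter_rectangle:
  assumes "a \<le> b" "c \<le> d"
  shows "semiperimeter ({a..b} \<times> {c..d}) = (b - a) + (d - c)"
  using assms by (simp add: semiperimeter_def)

lemma bounding_box_eq:
  assumes "A \<noteq> {}" "bounded A"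
  shows "bounding_box A =
    {Inf (fst ` A)..Sup (fst ` A)} \<times> {Inf (snd ` A)..Sup (snd ` A)}" (is "_ = ?B")
  unfolding bounding_box_def
proof (rule Least_equality)
  have bdd: "bdd_below (fst ` A)" "bdd_above (fst ` A)" "bdd_below (snd ` A)" "bdd_above (snd ` A)"
    using assms(2)
    by (simp_all add: bounded_fst bounded_snd bounded_imp_bdd_below bounded_imp_bdd_above)
  have "A \<subseteq> ?B"
  proof
    fix p assume "p \<in> A"
    then have "fst p \<in> fst ` A" "snd p \<in> snd ` A"
      by simp_all
    then show "p \<in> ?B"
      using bdd by (simp add: mem_Times_iff cInf_lower cSup_upper)
  qed
  moreover have "axis_parallel_rectangle ?B"
  proof -
    obtain p where "p \<in> ?B"
      using \<open>A \<subseteq> ?B\<close> assms(1) by blast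
    then have "Inf (fst ` A) \<le> Sup (fst ` A)" "Inf (snd ` A) \<le> Sup (snd ` A)"
      by (auto intro: order_trans)
    then show ?thesis
      unfolding axis_parallel_rectangle_def by blast
  qed
  ultimately show "axis_parallel_rectangle ?B \<and> A \<subseteq> ?B"
    by blast
next
  fix R assume "axis_parallel_rectangle R \<and> A \<subseteq> R"
  then obtain a b c d where R: "R = {a..b} \<times> {c..d}" and sub: "A \<subseteq> {a..b} \<times> {c..d}"
    unfolding axis_parallel_rectangle_def by blast
  have "a \<le> Inf (fst ` A)" "Sup (fst ` A) \<le> b" "c \<le> Inf (snd ` A)" "Sup (snd ` A) \<le> d"
    using assms(1) sub by (force intro: cInf_greatest cSup_least)+
  then show "?B \<le> R"
    unfolding R by (intro Sigma_mono) auto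
qed

end

theory Submission imports Defs begin

text \<open>
  Only the oriented lower left endpoints of the segments matter. By pigeonhole, at least
  \<open>4n + 1\<close> of the grandchildren of the root \<open>r\<close> lie in the same quadrant relative to \<open>r\<close>, say
  above and to the right. The corresponding legs form a staircase: going to the right they get
  lower, with offsets at most 1. A leg with a neighbour on either side in this bundle is squeezed
  between them, so that each edge leads either one unit further right or up, or one step back. Going
  back is impossible for more than two of the children of a subtree root, since the others would hit
  the parent of that root. Hence in every leg that is not near the border of the bundle some path
  runs right and up all the way down to a leaf, and this alone yields semiperimeter at least
  \<open>2n - 3\<close>. Each level of the trees costs two legs on either side of the bundle.
\<close>

section \<open>The trees\<close>

lemma Cons_mem_tree_verts [simp]:
  "i # y \<in> tree_verts (Node ts) \<longleftrightarrow> i < length ts \<and> y \<in> tree_verts (ts ! i)"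
  by auto

lemma Nil_mem_tree_verts [simp]: "[] \<in> tree_verts t"
  by (cases t) simp

lemma tree_verts_prefix: "x @ y \<in> tree_verts t \<Longrightarrow> x \<in> tree_verts t"
proof (induction x arbitrary: t)
  case (Cons i x)
  then show ?case by (cases t) (auto simp del: tree_verts.simps)
qed simp

lemma finite_tree_verts: "finite (tree_verts t)"
  by (induction t) auto

lemma singleton_mem_tree_verts_T: "i < 16 \<Longrightarrow> [i] \<in> tree_verts (T n)"
  by (subst T.simps) (simp del: tree_verts.simps)

text \<open>The \<open>0\<close> is the step from child \<open>i\<close> to its only child, so
  \<open>[i, 0]\<close> is the root of a copy of \<open>T (n - 1)\<close>.\<close>

lemma mem_tree_verts_T:
  assumes "n \<ge> 3" "i < 16 * n + 1" "y \<in> tree_verts (T (n - 1))"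
  shows "i # 0 # y \<in> tree_verts (T n)"
  using assms by (subst T.simps) (simp del: tree_verts.simps replicate.simps replicate_Suc)

definition nbr :: "nat list \<Rightarrow> nat list \<Rightarrow> bool" where
  "nbr u v \<longleftrightarrow> (\<exists>i. v = u @ [i] \<or> u = v @ [i])"

lemma nbr_commute: "nbr u v \<longleftrightarrow> nbr v u"
  by (auto simp: nbr_def)

lemma nbr_snoc [simp]: "nbr u (u @ [i])"
  by (auto simp: nbr_def)

lemma not_nbr_hd: "u \<noteq> [] \<Longrightarrow> v \<noteq> [] \<Longrightarrow> hd u \<noteq> hd v \<Longrightarrow> \<not> nbr u v"
  by (auto simp: nbr_def)

lemma tree_edges_iff_nbr:
  assumes "u \<in> tree_verts t" "v \<in> tree_verts t"
  shows "{u, v} \<in> tree_edges t \<longleftrightarrow> nbr u v"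
  using assms by (auto simp: tree_edges_def nbr_def doubleton_eq_iff)

section \<open>Antichains in the plane\<close>

text \<open>Two points with the same \<open>p\<close> would be comparable through \<open>q\<close>,
  so \<open>p\<close> is injective on \<open>I\<close>; sorting by \<open>p\<close> then forces
  \<open>q\<close> to decrease.\<close>

lemma antichain_enumeration:
  fixes p q :: "'a \<Rightarrow> real"
  assumes "finite I" "card I = m"
    and anti: "\<And>i j. i \<in> I \<Longrightarrow> j \<in> I \<Longrightarrow> i \<noteq> j \<Longrightarrow> \<not> (p i \<le> p j \<and> q i \<le> q j)"
  obtains e :: "nat \<Rightarrow> 'a" where "inj_on e {..<m}" "e ` {..<m} \<subseteq> I"
    "\<And>i j. i < j \<Longrightarrow> j < m \<Longrightarrow> p (e i) < p (e j) \<and> q (e j) < q (e i)"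
proof -
  have inj: "inj_on p I"
    using anti by (metis inj_onI linear order_refl)
  define xs where "xs = sorted_list_of_set (p ` I)"
  define e where "e = (\<lambda>i. inv_into I p (xs ! i))"
  have len: "length xs = m"
    using assms inj by (simp add: xs_def card_image)
  have mem: "xs ! i \<in> p ` I" if "i < m" for i
    using that assms(1) len nth_mem[of i xs] by (simp add: xs_def)
  have eI: "e i \<in> I" and pe: "p (e i) = xs ! i" if "i < m" for i
    using mem[OF that] by (simp_all add: e_def inv_into_into f_inv_into_f)
  have lt: "p (e i) < p (e j)" if "i < j" "j < m" for i j
  proof -
    have "sorted_wrt (<) xs"
      unfolding xs_def by (rule strict_sorted_list_of_set)
    then show ?thesis
      using that len by (simp add: pe sorted_wrt_nth_less)
  qed
  show thesis
  proof
    show "inj_on e {..<m}"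
      by (rule linorder_inj_onI) (use lt in \<open>force+\<close>)
    show "e ` {..<m} \<subseteq> I"
      using eI by auto
    show "p (e i) < p (e j) \<and> q (e j) < q (e i)" if "i < j" "j < m" for i j
    proof -
      have "e i \<noteq> e j"
        using lt[OF that] by auto
      then show ?thesis
        using lt[OF that] anti[of "e i" "e j"] eI[of i] eI[of j] that by force
    qed
  qed
qed

text \<open>Four free bounds instead of the bounding box itself, so that reflections and the swap of
  axes act directly on the statement.\<close>

definition in_box ::
    "nat list set \<Rightarrow> (nat list \<Rightarrow> bool) \<Rightarrow> (nat list \<Rightarrow> real) \<Rightarrow> (nat list \<Rightarrow> real) \<Rightarrow>
      real \<Rightarrow> real \<Rightarrow> real \<Rightarrow> real \<Rightarrow> bool" where
  "in_box W h p q a b c d \<longleftrightarrow>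
     (\<forall>u\<in>W. a \<le> p u \<and> p u + of_bool (h u) \<le> b \<and> c \<le> q u \<and> q u + of_bool (\<not> h u) \<le> d)"

section \<open>Stages of a representation\<close>

text \<open>A segment is encoded by its orientation (\<open>h u\<close> for horizontal) and its lower left
  endpoint \<open>(p u, q u)\<close>.\<close>

locale tree_rep =
  fixes W :: "nat list set" and h :: "nat list \<Rightarrow> bool" and p q :: "nat list \<Rightarrow> real"
  assumes nbr_orient: "u \<in> W \<Longrightarrow> v \<in> W \<Longrightarrow> nbr u v \<Longrightarrow> h u \<noteq> h v"
    and nbr_iff: "u \<in> W \<Longrightarrow> v \<in> W \<Longrightarrow> h u \<Longrightarrow> \<not> h v \<Longrightarrow>
      nbr u v \<longleftrightarrow> p u \<le> p v \<and> p v \<le> p u + 1 \<and> q v \<le> q u \<and> q u \<le> q v + 1"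
    and root_in: "[] \<in> W"
    and prefix_in: "x @ y \<in> W \<Longrightarrow> x \<in> W"
begin

text \<open>Stage \<open>k\<close> is the unit square of possible endpoints reached from the root by going
  alternately one unit to the right (along horizontal segments) and one unit up. The coordinates
  \<open>X k\<close>, \<open>Y k\<close> are normalised so that every stage is \<open>[0, 1]\<^sup>2\<close>; the root is the point
  \<open>(1, 1)\<close> of stage \<open>0\<close>.\<close>

definition X :: "nat \<Rightarrow> nat list \<Rightarrow> real" where
  "X k u = p u - (p [] - 1 + real ((k + 1) div 2))"

definition Y :: "nat \<Rightarrow> nat list \<Rightarrow> real" where
  "Y k u = q u - (q [] - 1 + real (k div 2))"

definition at_stage :: "nat \<Rightarrow> nat list \<Rightarrow> bool" where
  "at_stage k u \<longleftrightarrow> u \<in> W \<and> (h u \<longleftrightarrow> even k) \<and> 0 \<le> X k u \<and> X k u \<le> 1 \<and> 0 \<le> Y k u \<and> Y k u \<le> 1"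

definition lt :: "nat list \<Rightarrow> nat list \<Rightarrow> bool" where
  "lt u v \<longleftrightarrow> p u < p v \<and> q v < q u"

text \<open>\<open>X k\<close> and \<open>Y k\<close> are translates of \<open>p\<close> and
  \<open>q\<close>, so the staircase order can be read at any stage.\<close>

lemma lt_iff: "lt u v \<longleftrightarrow> X k u < X k v \<and> Y k v < Y k u"
  by (auto simp: lt_def X_def Y_def)

text \<open>Two of the four crossing inequalities hold automatically because both points lie in
  their unit squares. The other two become domination in normalised coordinates, which no longer
  depends on the parity of \<open>k\<close>.\<close>

lemma nbr_next:
  assumes "at_stage k u" "at_stage (Suc k) w"
  shows "nbr u w \<longleftrightarrow> X (Suc k) w \<le> X k u \<and> Y (Suc k) w \<le> Y k u"
proof (cases "even k")
  case True
  then obtain s where k: "k = 2 * s" by blast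
  show ?thesis
    using assms nbr_iff[of u w] by (auto simp: at_stage_def X_def Y_def k)
next
  case False
  then obtain s where k: "k = 2 * s + 1" by (blast elim: oddE)
  show ?thesis
    using assms nbr_iff[of w u] nbr_commute[of u w] by (auto simp: at_stage_def X_def Y_def k)
qed

text \<open>A staircase is inherited by private neighbours. Here \<open>b'\<close> is no higher than
  \<open>b\<close>, hence lower than \<open>u\<close>, so it can miss \<open>u\<close> only by lying
  to the right of it, and thus of \<open>w\<close>. Symmetrically, \<open>w\<close> can miss
  \<open>b\<close> only by lying above it.\<close>

lemma lt_forward:
  assumes "at_stage k u" "at_stage k b" "at_stage (Suc k) w" "at_stage (Suc k) b'" "lt u b"
    "nbr u w" "nbr b b'" "\<not> nbr u b'" "\<not> nbr b w"
  shows "lt w b'"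
  using assms by (auto simp: nbr_next[where k = k] lt_iff[of u b k] lt_iff[of w b' "Suc k"])

lemma lt_backward:
  assumes "at_stage (Suc k) u" "at_stage (Suc k) b" "at_stage k w" "at_stage k b'" "lt u b"
    "nbr w u" "nbr b' b" "\<not> nbr b' u" "\<not> nbr w b"
  shows "lt w b'"
  using assms by (auto simp: nbr_next[where k = k] lt_iff[of u b "Suc k"] lt_iff[of w b' k])

text \<open>Relative to the two squares of stages \<open>k\<close> and \<open>k + 2\<close>, a
  neighbour of \<open>u\<close> can otherwise lie only too far to one side in both coordinates: a
  horizontal one up and to the left, where it hits \<open>u1\<close>, or down and to the right,
  where it hits \<open>u2\<close>. For a vertical one the roles of \<open>u1\<close> and
  \<open>u2\<close> change accordingly.\<close>

lemma nbr_between_stages: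
  assumes "at_stage (Suc k) u" "at_stage (Suc k) u1" "at_stage (Suc k) u2" "lt u1 u" "lt u u2"
    and w: "w \<in> W" "nbr u w" "\<not> nbr u1 w" "\<not> nbr u2 w"
  shows "at_stage k w \<or> at_stage (Suc (Suc k)) w"
proof (cases "even k")
  case True
  then obtain s where k: "k = 2 * s" by blast
  have o: "h w"
    using assms nbr_orient[of u w] by (auto simp: at_stage_def k)
  show ?thesis
    using assms o nbr_iff[of w u] nbr_iff[of w u1] nbr_iff[of w u2]
      nbr_commute[of w u] nbr_commute[of w u1] nbr_commute[of w u2]
    by (auto simp: at_stage_def X_def Y_def k lt_def)
next
  case False
  then obtain s where k: "k = 2 * s + 1" by (blast elim: oddE)
  have o: "\<not> h w"
    using assms nbr_orient[of u w] by (auto simp: at_stage_def k)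
  show ?thesis
    using assms o nbr_iff[of u w] nbr_iff[of u1 w] nbr_iff[of u2 w]
    by (auto simp: at_stage_def X_def Y_def k lt_def)
qed

text \<open>Among three steps of the same kind one is in the middle. A middle step back would hit
  \<open>x\<close>, the parent of \<open>u\<close>. A middle step forward has no child going back,
  since that child would hit \<open>u\<close>.\<close>

lemma forward_grandchild:
  assumes x: "at_stage k x" and u: "at_stage (Suc k) u" "u = x @ [0]"
    and v: "\<And>i. i < 5 \<Longrightarrow> at_stage (Suc (Suc k)) (u @ [i])"
    and w: "\<And>i. i < 5 \<Longrightarrow>
      at_stage (Suc k) (u @ [i, 0]) \<or> at_stage (Suc (Suc (Suc k))) (u @ [i, 0])"
  obtains i where "i < 5" "at_stage (Suc (Suc (Suc k))) (u @ [i, 0])"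
    "\<And>a. \<not> at_stage (Suc (Suc k)) (u @ [i, 0, a])"
proof -
  \<comment> \<open>\<open>A\<close> collects the steps back and \<open>B\<close> the steps forward.
    With five indices, one of the two sets has at least three.\<close>
  define A where "A = {i. i < 5 \<and> at_stage (Suc k) (u @ [i, 0])}"
  define B where "B = {i. i < 5 \<and> at_stage (Suc (Suc (Suc k))) (u @ [i, 0])}"
  have fin: "finite A" "finite B"
    by (auto simp: A_def B_def)
  have vu: "X (Suc (Suc k)) (u @ [i]) \<le> X (Suc k) u" "Y (Suc (Suc k)) (u @ [i]) \<le> Y (Suc k) u"
    if "i < 5" for i
    using nbr_next[OF u(1) v[OF that]] by auto
  have ux: "X (Suc k) u \<le> X k x" "Y (Suc k) u \<le> Y k x"
    using nbr_next[OF x u(1)] u(2) by auto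
  have "A \<union> B = {..<5}"
    using w by (auto simp: A_def B_def)
  then have "5 \<le> card A + card B"
    using card_Un_le[of A B] by simp
  then consider "3 \<le> card A" | "3 \<le> card B" by linarith
  then show thesis
  proof cases
    case 1
    then obtain I where I: "I \<subseteq> A" "finite I" "card I = 3"
      using obtain_subset_with_card_n by metis
    \<comment> \<open>If child \<open>i\<close> were dominated by child \<open>j\<close>, it would
      also be dominated by the neighbour \<open>u @ [j, 0]\<close> of \<open>j\<close> and hence
      adjacent to it.\<close>
    have anti: "\<not> (X (Suc (Suc k)) (u @ [i]) \<le> X (Suc (Suc k)) (u @ [j]) \<and>
        Y (Suc (Suc k)) (u @ [i]) \<le> Y (Suc (Suc k)) (u @ [j]))" if "i \<in> I" "j \<in> I" "i \<noteq> j" for i j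
    proof -
      have ij: "i < 5" "j < 5" "at_stage (Suc k) (u @ [j, 0])"
        using that I(1) by (auto simp: A_def)
      have "nbr (u @ [j, 0]) (u @ [j])" "\<not> nbr (u @ [j, 0]) (u @ [i])"
        using \<open>i \<noteq> j\<close> by (auto simp: nbr_def)
      then show ?thesis
        using nbr_next[OF ij(3) v[OF ij(1)]] nbr_next[OF ij(3) v[OF ij(2)]] by auto
    qed
    obtain e :: "nat \<Rightarrow> nat"
      where e: "inj_on e {..<3}" "e ` {..<3} \<subseteq> I"
        "\<And>i j. i < j \<Longrightarrow> j < 3 \<Longrightarrow> X (Suc (Suc k)) (u @ [e i]) < X (Suc (Suc k)) (u @ [e j]) \<and>
          Y (Suc (Suc k)) (u @ [e j]) < Y (Suc (Suc k)) (u @ [e i])"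
      using antichain_enumeration[of I 3 "\<lambda>i. X (Suc (Suc k)) (u @ [i])"
        "\<lambda>i. Y (Suc (Suc k)) (u @ [i])", OF I(2,3) anti] by blast
    have "e i \<in> A" if "i < 3" for i
      using e(2) I(1) that by auto
    then have eA: "e 0 \<in> A" "e 1 \<in> A" "e 2 \<in> A"
      by auto
    have ne: "e 0 \<noteq> e 1" "e 2 \<noteq> e 1"
      using inj_onD[OF e(1), of 0 1] inj_onD[OF e(1), of 2 1] by auto
    have w1: "at_stage (Suc k) (u @ [e 1, 0])" and lt5: "e 0 < 5" "e 1 < 5" "e 2 < 5"
      using eA by (auto simp: A_def)
    have "nbr (u @ [e 1, 0]) (u @ [e 1])" "\<not> nbr (u @ [e 1, 0]) (u @ [e 0])"
      "\<not> nbr (u @ [e 1, 0]) (u @ [e 2])"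
      using ne by (auto simp: nbr_def)
    \<comment> \<open>The middle grandchild misses both outer children, which caps its two
      coordinates. The outer children are dominated by \<open>u\<close>, and \<open>u\<close> by
      \<open>x\<close>.\<close>
    then have "X (Suc k) (u @ [e 1, 0]) < X (Suc (Suc k)) (u @ [e 2])"
      "Y (Suc k) (u @ [e 1, 0]) < Y (Suc (Suc k)) (u @ [e 0])"
      using nbr_next[OF w1 v[OF lt5(1)]] nbr_next[OF w1 v[OF lt5(2)]] nbr_next[OF w1 v[OF lt5(3)]]
        e(3)[of 0 1] e(3)[of 1 2] by auto
    then have "nbr x (u @ [e 1, 0])"
      using vu[OF lt5(1)] vu[OF lt5(3)] ux nbr_next[OF x w1] by auto
    then show thesis
      by (auto simp: nbr_def u(2))
  next
    case 2
    then obtain I where I: "I \<subseteq> B" "finite I" "card I = 3"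
      using obtain_subset_with_card_n by metis
    have anti: "\<not> (p (u @ [i]) \<le> p (u @ [j]) \<and> q (u @ [i]) \<le> q (u @ [j]))"
      if "i \<in> I" "j \<in> I" "i \<noteq> j" for i j
    proof -
      have ij: "i < 5" "j < 5" "at_stage (Suc (Suc (Suc k))) (u @ [i, 0])"
        using that I(1) by (auto simp: B_def)
      have "nbr (u @ [i]) (u @ [i, 0])" "\<not> nbr (u @ [j]) (u @ [i, 0])"
        using \<open>i \<noteq> j\<close> by (auto simp: nbr_def)
      then show ?thesis
        using nbr_next[OF v[OF ij(1)] ij(3)] nbr_next[OF v[OF ij(2)] ij(3)]
        by (auto simp: X_def Y_def)
    qed
    obtain e :: "nat \<Rightarrow> nat"
      where e: "inj_on e {..<3}" "e ` {..<3} \<subseteq> I"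
        "\<And>i j. i < j \<Longrightarrow> j < 3 \<Longrightarrow> lt (u @ [e i]) (u @ [e j])"
      using antichain_enumeration[of I 3 "\<lambda>i. p (u @ [i])" "\<lambda>i. q (u @ [i])", OF I(2,3) anti]
      unfolding lt_def by blast
    have eB: "e i \<in> B" if "i < 3" for i
      using e(2) I(1) that by auto
    have lt5: "e i < 5" and w3: "at_stage (Suc (Suc (Suc k))) (u @ [e i, 0])" if "i < 3" for i
      using eB[OF that] by (auto simp: B_def)
    have ne: "e i \<noteq> e j" if "i < j" "j < 3" for i j
      using inj_onD[OF e(1), of i j] that by auto
    have ltw: "lt (u @ [e i, 0]) (u @ [e j, 0])" if "i < j" "j < 3" for i j
      by (rule lt_forward[of "Suc (Suc k)" "u @ [e i]" "u @ [e j]"])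
        (use that lt5 w3 v e(3) ne[OF that] in \<open>auto simp: nbr_def\<close>)
    \<comment> \<open>A child going back would lie on the staircase between the outer children of
      \<open>u\<close>, so both its coordinates would be bounded by those of
      \<open>u\<close>.\<close>
    have "\<not> at_stage (Suc (Suc k)) (u @ [e 1, 0, a])" for a
    proof
      assume a: "at_stage (Suc (Suc k)) (u @ [e 1, 0, a])"
      have "lt (u @ [e 0]) (u @ [e 1, 0, a])"
        by (rule lt_backward[of "Suc (Suc k)" "u @ [e 0, 0]" "u @ [e 1, 0]"])
          (use a lt5 w3 v ltw ne[of 0 1] in \<open>auto simp: nbr_def\<close>)
      moreover have "lt (u @ [e 1, 0, a]) (u @ [e 2])"
        by (rule lt_backward[of "Suc (Suc k)" "u @ [e 1, 0]" "u @ [e 2, 0]"])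
          (use a lt5 w3 v ltw ne[of 1 2] in \<open>auto simp: nbr_def\<close>)
      ultimately have "nbr u (u @ [e 1, 0, a])"
        using nbr_next[OF u(1) a] vu[OF lt5[of 0]] vu[OF lt5[of 2]]
        by (auto simp: lt_iff[where k = "Suc (Suc k)"])
      then show False
        by (auto simp: nbr_def)
    qed
    then show thesis
      using that[of "e 1"] lt5[of 1] w3[of 1] by auto
  qed
qed

section \<open>Descent through the leg bundles\<close>

text \<open>The invariant of the descent: roots \<open>g j\<close> of copies of \<open>T m\<close> in different branches, all of
  whose children lie one stage further. The constant \<open>c\<close> is the height of the lowest child of the
  root of the whole tree; it is carried along for the final estimate.\<close>

definition leg_bundle :: "nat \<Rightarrow> nat \<Rightarrow> nat \<Rightarrow> real \<Rightarrow> (nat \<Rightarrow> nat list) \<Rightarrow> bool" where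
  "leg_bundle k m L c g \<longleftrightarrow>
     (\<forall>j<L. at_stage (Suc k) (g j) \<and> (\<forall>y\<in>tree_verts (T m). g j @ y \<in> W) \<and> c \<le> Y (Suc k) (g j) \<and>
       (\<exists>x. x \<noteq> [] \<and> g j = x @ [0] \<and> at_stage k x) \<and>
       (\<forall>i. g j @ [i] \<in> W \<longrightarrow> at_stage (Suc (Suc k)) (g j @ [i]))) \<and>
     (\<forall>i j. i < j \<longrightarrow> j < L \<longrightarrow> lt (g i) (g j) \<and> hd (g i) \<noteq> hd (g j))"

lemma leg_bundle_step:
  assumes g: "leg_bundle k m L c g" and m: "m \<ge> 3"
  obtains g' where "leg_bundle (Suc (Suc k)) (m - 1) (L - 4) c g'"
proof -
  let ?k1 = "Suc k" and ?k2 = "Suc (Suc k)" and ?k3 = "Suc (Suc (Suc k))"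
  let ?k4 = "Suc (Suc (Suc (Suc k)))"
  have at1: "at_stage ?k1 (g j)" and cY: "c \<le> Y ?k1 (g j)"
    and sub: "\<And>y. y \<in> tree_verts (T m) \<Longrightarrow> g j @ y \<in> W"
    and ch: "\<And>i. g j @ [i] \<in> W \<Longrightarrow> at_stage ?k2 (g j @ [i])" if "j < L" for j
    using g that by (auto simp: leg_bundle_def)
  have ltg: "lt (g i) (g j)" and hdg: "hd (g i) \<noteq> hd (g j)" if "i < j" "j < L" for i j
    using g that by (auto simp: leg_bundle_def)
  have ne: "g j \<noteq> []" if "j < L" for j
    using g that by (auto simp: leg_bundle_def)
  \<comment> \<open>Distinct first indices put the legs into different branches at the root of the
    whole tree, and no edge joins two such branches.\<close>
  have far: "\<not> nbr (g i @ x) (g j @ y)" "\<not> nbr (g j @ y) (g i @ x)" if "i < j" "j < L" for i j x y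
    using hdg[OF that] ne[of i] ne[of j] that
    by (metis append_is_Nil_conv hd_append2 not_nbr_hd less_trans)+
  have far0: "\<not> nbr (g i) (g j @ y)" "\<not> nbr (g j) (g i @ y)" if "i < j" "j < L" for i j y
    using far(1)[OF that, of "[]" y] far(2)[OF that, of "[]" y] by auto
  have v: "at_stage ?k2 (g j @ [i])" if "j < L" "i < 16" for i j
    using ch sub singleton_mem_tree_verts_T that by auto
  have sub2: "g j @ i # 0 # y \<in> W" if "j < L" "i < 5" "y \<in> tree_verts (T (m - 1))" for i j y
    using sub[OF that(1)] mem_tree_verts_T[OF m, of i y] that m by auto
  have ltv: "lt (g i @ [a]) (g j @ [b])" if "i < j" "j < L" "a < 16" "b < 16" for i j a b
    by (rule lt_forward[of ?k1 "g i" "g j"])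
      (use that at1 v ltg far0 in \<open>auto simp: far0\<close>)
  define P where "P j i \<longleftrightarrow> i < 5 \<and> at_stage ?k3 (g j @ [i, 0]) \<and>
    (\<forall>a. \<not> at_stage ?k2 (g j @ [i, 0, a]))" for j i
  \<comment> \<open>First loss of one leg per side: the children of \<open>g j\<close> must be
    squeezed between children of \<open>g (j - 1)\<close> and \<open>g (j + 1)\<close>.\<close>
  have "\<exists>i. P j i" if j: "0 < j" "j + 1 < L" for j
  proof -
    have "j < L"
      using j by simp
    then obtain x where x: "x \<noteq> []" "g j = x @ [0]" "at_stage k x"
      using g unfolding leg_bundle_def by blast
    have "at_stage ?k1 (g j @ [i, 0]) \<or> at_stage ?k3 (g j @ [i, 0])" if i: "i < 5" for i
    proof (rule nbr_between_stages)
      show "at_stage ?k2 (g j @ [i])" "at_stage ?k2 (g (j - 1) @ [0])" "at_stage ?k2 (g (j + 1) @ [0])"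
        using v i j by auto
      show "lt (g (j - 1) @ [0]) (g j @ [i])" "lt (g j @ [i]) (g (j + 1) @ [0])"
        using ltv i j by auto
      show "g j @ [i, 0] \<in> W"
        using sub2[of j i "[]"] i j by auto
      show "nbr (g j @ [i]) (g j @ [i, 0])"
        by (auto simp: nbr_def)
      show "\<not> nbr (g (j - 1) @ [0]) (g j @ [i, 0])" "\<not> nbr (g (j + 1) @ [0]) (g j @ [i, 0])"
        using far j by auto
    qed
    moreover have "at_stage ?k2 (g j @ [i])" if "i < 5" for i
      using v[OF \<open>j < L\<close>, of i] that by simp
    ultimately obtain i where "i < 5" "at_stage ?k3 (g j @ [i, 0])"
      "\<And>a. \<not> at_stage ?k2 (g j @ [i, 0, a])"
      using forward_grandchild[OF x(3) at1[OF \<open>j < L\<close>] x(2)] by blast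
    then show ?thesis
      unfolding P_def by blast
  qed
  then obtain e where e: "P j (e j)" if "0 < j" "j + 1 < L" for j
    by metis
  define f where "f j = g j @ [e j, 0]" for j
  have e5: "e j < 5" and f3: "at_stage ?k3 (f j)" and f2: "\<not> at_stage ?k2 (f j @ [a])"
    if "0 < j" "j + 1 < L" for j a
    using e[OF that] by (auto simp: P_def f_def)
  have nbrf: "nbr (g j @ [e j]) (f j)" for j
    by (auto simp: nbr_def f_def)
  have ltf: "lt (f i) (f j)" if "0 < i" "i < j" "j + 1 < L" for i j
  proof (rule lt_forward[of ?k2 "g i @ [e i]" "g j @ [e j]"])
    show "at_stage ?k2 (g i @ [e i])" "at_stage ?k2 (g j @ [e j])"
      using v e5[of i] e5[of j] that by auto
    show "at_stage ?k3 (f i)" "at_stage ?k3 (f j)"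
      using f3 that by auto
    show "lt (g i @ [e i]) (g j @ [e j])"
      using ltv e5[of i] e5[of j] that by auto
    show "\<not> nbr (g i @ [e i]) (f j)" "\<not> nbr (g j @ [e j]) (f i)"
      using far that by (auto simp: f_def)
  qed (rule nbrf)+
  have fW: "f j @ y \<in> W" if "0 < j" "j + 1 < L" "y \<in> tree_verts (T (m - 1))" for j y
    using sub2[of j "e j" y] e5 that by (auto simp: f_def)
  \<comment> \<open>Second loss of one leg per side: now \<open>f j\<close> is squeezed between
    \<open>f (j - 1)\<close> and \<open>f (j + 1)\<close>. The alternative of stepping back was
    excluded by the choice of \<open>e j\<close>.\<close>
  have f4: "at_stage ?k4 (f j @ [a])" if j: "1 < j" "j + 2 < L" and W: "f j @ [a] \<in> W" for j a
  proof -
    have "at_stage ?k2 (f j @ [a]) \<or> at_stage ?k4 (f j @ [a])"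
    proof (rule nbr_between_stages)
      show "at_stage ?k3 (f j)" "at_stage ?k3 (f (j - 1))" "at_stage ?k3 (f (j + 1))"
        using f3 j by auto
      show "lt (f (j - 1)) (f j)" "lt (f j) (f (j + 1))"
        using ltf j by auto
      show "\<not> nbr (f (j - 1)) (f j @ [a])" "\<not> nbr (f (j + 1)) (f j @ [a])"
        using far j by (auto simp: f_def)
    qed (use W in auto)
    then show ?thesis
      using f2 j by auto
  qed
  \<comment> \<open>The bound passes from leg \<open>j + 2\<close> to a child of leg
    \<open>j + 1\<close> and on to \<open>f j\<close>: each time the upper left vertex misses the
    lower right one and so stays above it.\<close>
  have cf: "c \<le> Y ?k3 (f j)" if j: "1 < j" "j + 2 < L" for j
  proof -
    have v1: "at_stage ?k2 (g j @ [e j])" "at_stage ?k2 (g (j + 1) @ [0])"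
      using v e5[of j] j by auto
    have 1: "lt (g j @ [e j]) (g (j + 1) @ [0])"
      using ltv e5[of j] j by auto
    have "\<not> nbr (g (j + 1) @ [0]) (f j)"
      using far j by (auto simp: f_def)
    then have "Y ?k2 (g (j + 1) @ [0]) < Y ?k3 (f j)"
      using nbr_next[OF v1(2) f3[of j]] nbr_next[OF v1(1) f3[of j]] nbrf[of j] j
        1[unfolded lt_iff[where k = ?k2]] by auto
    moreover have "Y ?k1 (g (j + 2)) < Y ?k2 (g (j + 1) @ [0])"
      using nbr_next[OF at1[of "j + 2"] v1(2)] nbr_next[OF at1[of "j + 1"] v1(2)] j
        ltg[of "j + 1" "j + 2"] far0[of "j + 1" "j + 2"] by (auto simp: lt_iff[where k = ?k1])
    ultimately show ?thesis
      using cY[of "j + 2"] j by auto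
  qed
  have "leg_bundle ?k2 (m - 1) (L - 4) c (\<lambda>j. f (j + 2))"
    unfolding leg_bundle_def
  proof (intro conjI allI impI ballI)
    fix j assume j: "j < L - 4"
    show "at_stage ?k3 (f (j + 2))" "c \<le> Y ?k3 (f (j + 2))"
      using f3 cf j by auto
    show "f (j + 2) @ y \<in> W" if "y \<in> tree_verts (T (m - 1))" for y
      using fW j that by auto
    show "at_stage ?k4 (f (j + 2) @ [i])" if "f (j + 2) @ [i] \<in> W" for i
      using f4[of "j + 2" i] j that by auto
    show "\<exists>x. x \<noteq> [] \<and> f (j + 2) = x @ [0] \<and> at_stage ?k2 x"
      using v[of "j + 2" "e (j + 2)"] less_trans[OF e5[of "j + 2"], of 16] j
      by (intro exI[of _ "g (j + 2) @ [e (j + 2)]"]) (auto simp: f_def)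
  next
    fix i j assume "i < j" "j < L - 4"
    then show "lt (f (i + 2)) (f (j + 2))" "hd (f (i + 2)) \<noteq> hd (f (j + 2))"
      using ltf[of "i + 2" "j + 2"] hdg[of "i + 2" "j + 2"] ne[of "i + 2"] ne[of "j + 2"]
      by (auto simp: f_def)
  qed
  then show thesis
    using that by blast
qed

lemma quadrant_bound:
  assumes n: "n \<ge> 3" and W: "W = tree_verts (T n)" and root: "h []"
    and J: "J \<subseteq> {..<16 * n + 1}" "card J = 4 * n + 1"
    and quadrant: "\<And>i. i \<in> J \<Longrightarrow> p [] \<le> p [i, 0] \<and> q [] \<le> q [i, 0]"
    and box: "in_box W h p q a b c d"
  shows "real n \<le> (b - a) + (d - c)"
proof -
  have W2: "i # 0 # y \<in> W" if "i \<in> J" "y \<in> tree_verts (T (n - 1))" for i y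
    using mem_tree_verts_T[OF n, of i y] J(1) that W by auto
  have W1: "[i, 0] \<in> W" "[i] \<in> W" if "i \<in> J" for i
    using W2[OF that, of "[]"] prefix_in[of "[i]" "[0]"] by auto
  have nbr1: "nbr [] [i]" "nbr [i] [i, 0]" for i
    by (auto simp: nbr_def)
  have h: "\<not> h [i]" "h [i, 0]" if "i \<in> J" for i
    using nbr_orient[OF root_in W1(2)[OF that] nbr1(1)]
      nbr_orient[OF W1(2)[OF that] W1(1)[OF that] nbr1(2)] root by auto
  have s0: "at_stage 0 []"
    by (simp add: at_stage_def root root_in X_def Y_def)
  have s1: "at_stage (Suc 0) [i]" if "i \<in> J" for i
    using nbr_iff[OF root_in W1(2)[OF that] root h(1)[OF that]] nbr1 h[OF that] W1[OF that]
    by (auto simp: at_stage_def X_def Y_def)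
  have s2: "at_stage (Suc (Suc 0)) [i, 0]" if "i \<in> J" for i
    using nbr_iff[OF root_in W1(2)[OF that] root h(1)[OF that]]
      nbr_iff[OF W1(1)[OF that] W1(2)[OF that] h(2)[OF that] h(1)[OF that]]
      nbr1 nbr_commute[of "[i]" "[i, 0]"] h[OF that] W1[OF that] quadrant[OF that]
    by (auto simp: at_stage_def X_def Y_def)
  \<comment> \<open>The grandchild \<open>[i, 0]\<close> is dominated by \<open>[i]\<close>; were
    \<open>[i]\<close> dominated by \<open>[j]\<close>, then \<open>[i, 0]\<close> would also be
    adjacent to \<open>[j]\<close>.\<close>
  have anti: "\<not> (p [i] \<le> p [j] \<and> q [i] \<le> q [j])" if "i \<in> J" "j \<in> J" "i \<noteq> j" for i j
  proof -
    have "\<not> nbr [j] [i, 0]"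
      using that by (auto simp: nbr_def)
    then show ?thesis
      using nbr_next[OF s1 s2, of i i] nbr_next[OF s1 s2, of j i] nbr1[of i] that
      by (auto simp: X_def Y_def)
  qed
  have "finite J"
    using J(1) finite_subset by blast
  then obtain e :: "nat \<Rightarrow> nat" where e: "inj_on e {..<4 * n + 1}" "e ` {..<4 * n + 1} \<subseteq> J"
    "\<And>i j. i < j \<Longrightarrow> j < 4 * n + 1 \<Longrightarrow> lt [e i] [e j]"
    using antichain_enumeration[of J "4 * n + 1" "\<lambda>i. p [i]" "\<lambda>i. q [i]"] J(2) anti
    unfolding lt_def by blast
  have eJ: "e i \<in> J" if "i < 4 * n + 1" for i
    using e(2) that by auto
  have ne: "e i \<noteq> e j" "e j \<noteq> e i" if "i < j" "j < 4 * n + 1" for i j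
    using inj_onD[OF e(1), of i j] that by auto
  have lt2: "lt [e i, 0] [e j, 0]" if "i < j" "j < 4 * n + 1" for i j
    by (rule lt_forward[of "Suc 0" "[e i]" "[e j]"])
      (use that s1 s2 eJ e(3) ne[OF that] in \<open>auto simp: nbr_def\<close>)
  \<comment> \<open>The last point of the staircase is the lowest of the chosen children.\<close>
  define z where "z = [e (4 * n)]"
  define Z where "Z = Y (Suc 0) z"
  have z: "z \<in> W" "at_stage (Suc 0) z"
    using W1 s1 eJ by (auto simp: z_def)
  \<comment> \<open>The two outermost of the \<open>4 * n + 1\<close> legs serve only to squeeze the
    others.\<close>
  have start: "leg_bundle (Suc 0) (n - 1) (4 * n - 1) Z (\<lambda>j. [e (j + 1), 0])"
    unfolding leg_bundle_def
  proof (intro conjI allI impI ballI)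
    fix j assume "j < 4 * n - 1"
    then have j: "j + 2 < 4 * n + 1" by simp
    show "at_stage (Suc (Suc 0)) [e (j + 1), 0]"
      using s2 eJ j by auto
    show "[e (j + 1), 0] @ y \<in> W" if "y \<in> tree_verts (T (n - 1))" for y
      using W2 eJ j that by auto
    have "\<not> nbr z [e (j + 1), 0]"
      using ne[of "j + 1" "4 * n"] j by (auto simp: nbr_def z_def)
    then show "Z \<le> Y (Suc (Suc 0)) [e (j + 1), 0]"
      using nbr_next[OF z(2) s2[of "e (j + 1)"]] nbr_next[OF s1 s2, of "e (j + 1)" "e (j + 1)"]
        nbr1[of "e (j + 1)"] eJ[of "j + 1"] e(3)[of "j + 1" "4 * n"] j
      by (auto simp: lt_iff[where k = "Suc 0"] z_def Z_def)
    show "\<exists>x. x \<noteq> [] \<and> [e (j + 1), 0] = x @ [0] \<and> at_stage (Suc 0) x"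
      using s1 eJ j by auto
    show "at_stage (Suc (Suc (Suc 0))) ([e (j + 1), 0] @ [i])" if "[e (j + 1), 0] @ [i] \<in> W" for i
    proof -
      have "at_stage (Suc 0) ([e (j + 1), 0] @ [i]) \<or>
        at_stage (Suc (Suc (Suc 0))) ([e (j + 1), 0] @ [i])"
        by (rule nbr_between_stages[of "Suc 0" "[e (j + 1), 0]" "[e j, 0]" "[e (j + 2), 0]"])
          (use s2 eJ lt2 j that ne[of j "j + 1"] ne[of "j + 1" "j + 2"] in \<open>auto simp: nbr_def\<close>)
      \<comment> \<open>The root is the corner \<open>(1, 1)\<close> of stage 0, so it is adjacent
        to everything at stage 1, but not to a vertex of depth 3.\<close>
      moreover have "\<not> at_stage (Suc 0) ([e (j + 1), 0] @ [i])"
      proof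
        assume *: "at_stage (Suc 0) ([e (j + 1), 0] @ [i])"
        then have "nbr [] ([e (j + 1), 0] @ [i])"
          by (subst nbr_next[OF s0 *]) (auto simp: at_stage_def X_def[of 0] Y_def[of 0])
        then show False
          by (auto simp: nbr_def)
      qed
      ultimately show ?thesis by blast
    qed
  next
    fix i j assume "i < j" "j < 4 * n - 1"
    then show "lt [e (i + 1), 0] [e (j + 1), 0]" "hd [e (i + 1), 0] \<noteq> hd [e (j + 1), 0]"
      using lt2 ne[of "i + 1" "j + 1"] by auto
  qed
  \<comment> \<open>Each round passes two stages and costs four legs. After \<open>n - 3\<close>
    rounds the copies are \<open>T 2\<close> and 11 legs remain.\<close>
  have "\<exists>g. leg_bundle (2 * t + 1) (n - 1 - t) (4 * n - 1 - 4 * t) Z g" if "t \<le> n - 3" for t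
    using that
  proof (induction t)
    case 0
    then show ?case using start by auto
  next
    case (Suc t)
    then obtain g where "leg_bundle (2 * t + 1) (n - 1 - t) (4 * n - 1 - 4 * t) Z g"
      by auto
    moreover have "n - 1 - t \<ge> 3"
      using Suc.prems by auto
    ultimately obtain g' where
      "leg_bundle (Suc (Suc (2 * t + 1))) (n - 1 - t - 1) (4 * n - 1 - 4 * t - 4) Z g'"
      by (rule leg_bundle_step)
    then show ?case
      by (auto simp: algebra_simps)
  qed
  from this[of "n - 3"]
  obtain g where g: "leg_bundle (2 * (n - 3) + 1) (n - 1 - (n - 3)) (4 * n - 1 - 4 * (n - 3)) Z g"
    by auto
  define t where "t = n - 3"
  have nt: "n = t + 3"
    using n by (simp add: t_def)
  have g: "leg_bundle (2 * t + 1) 2 11 Z g"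
    using g by (simp add: nt)
  \<comment> \<open>The leaf \<open>v\<close> hangs below leg \<open>0\<close>; missing leg
    \<open>1\<close>, which is lower, keeps it above height \<open>Z\<close>.\<close>
  define v where "v = g 0 @ [0]"
  have g01: "at_stage (2 * t + 2) (g 0)" "at_stage (2 * t + 2) (g 1)" "lt (g 0) (g 1)"
      "Z \<le> Y (2 * t + 2) (g 1)" "g 0 \<noteq> []" "g 1 \<noteq> []" "hd (g 0) \<noteq> hd (g 1)" "v \<in> W"
      "at_stage (Suc (2 * t + 2)) v"
    using g[unfolded leg_bundle_def, THEN conjunct1, rule_format, of 0]
      g[unfolded leg_bundle_def, THEN conjunct1, rule_format, of 1]
      g[unfolded leg_bundle_def, THEN conjunct2, rule_format, of 0 1]
      singleton_mem_tree_verts_T[of 0 2] by (auto simp: v_def)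
  have "nbr (g 0) v" "\<not> nbr (g 1) v"
    using g01(5-7) not_nbr_hd[of "g 1" v] by (auto simp: v_def)
  then have "Z \<le> Y (Suc (2 * t + 2)) v"
    using nbr_next[OF g01(1,9)] nbr_next[OF g01(2,9)] g01(3,4)
    by (auto simp: lt_iff[where k = "2 * t + 2"])
  then have "q z + real t + 1 \<le> q v"
    by (simp add: Y_def Z_def)
  moreover have "\<not> h v" "p [] + real t + 1 \<le> p v"
    using g01(9) by (auto simp: at_stage_def X_def)
  moreover have "a \<le> p []" "p v + of_bool (h v) \<le> b" "c \<le> q z" "q v + of_bool (\<not> h v) \<le> d"
    using box g01(8) z(1) root_in by (auto simp: in_box_def)
  \<comment> \<open>The width is at least \<open>t + 1\<close> and the height at least
    \<open>t + 2\<close>, the last unit being the length of \<open>v\<close>; the sum is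
    \<open>2 * n - 3\<close>. Measuring the height from the root instead of \<open>z\<close> would
    yield only \<open>2 * n - 4\<close>, too little for \<open>n = 3\<close>.\<close>
  ultimately show ?thesis
    by (simp add: nt)
qed

end

section \<open>Symmetries\<close>

text \<open>After the reflection the former right endpoint becomes the left one, hence the extra
  \<open>of_bool (h u)\<close>.\<close>

lemma tree_rep_reflect_x:
  assumes "tree_rep W h p q"
  shows "tree_rep W h (\<lambda>u. - p u - of_bool (h u)) q"
proof -
  interpret tree_rep W h p q by fact
  show ?thesis
  proof (unfold_locales, goal_cases)
    case (1 u v)
    then show ?case using nbr_orient[of u v] by simp
  next
    case (2 u v)
    then show ?case using nbr_iff[of u v] by auto
  qed (fact root_in, fact prefix_in)
qed

lemma tree_rep_reflect_y:
  assumes "tree_rep W h p q"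
  shows "tree_rep W h p (\<lambda>u. - q u - of_bool (\<not> h u))"
proof -
  interpret tree_rep W h p q by fact
  show ?thesis
  proof (unfold_locales, goal_cases)
    case (1 u v)
    then show ?case using nbr_orient[of u v] by simp
  next
    case (2 u v)
    then show ?case using nbr_iff[of u v] by auto
  qed (fact root_in, fact prefix_in)
qed

lemma tree_rep_swap:
  assumes "tree_rep W h p q"
  shows "tree_rep W (\<lambda>u. \<not> h u) q p"
proof -
  interpret tree_rep W h p q by fact
  show ?thesis
  proof (unfold_locales, goal_cases)
    case (1 u v)
    then show ?case using nbr_orient[of u v] by simp
  next
    case (2 u v)
    then show ?case using nbr_iff[of v u] nbr_commute[of u v] by auto
  qed (fact root_in, fact prefix_in)
qed

lemma in_box_reflect_x:
  "in_box W h p q a b c d \<Longrightarrow> in_box W h (\<lambda>u. - p u - of_bool (h u)) q (- b) (- a) c d"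
  unfolding in_box_def by force

lemma in_box_reflect_y:
  "in_box W h p q a b c d \<Longrightarrow> in_box W h p (\<lambda>u. - q u - of_bool (\<not> h u)) a b (- d) (- c)"
  unfolding in_box_def by force

lemma in_box_swap: "in_box W h p q a b c d \<Longrightarrow> in_box W (\<lambda>u. \<not> h u) q p c d a b"
  unfolding in_box_def by auto

text \<open>Four sets cover \<open>16 * n + 1\<close> grandchildren, so one has at least
  \<open>4 * n + 1\<close> elements; reflections move it to the upper right quadrant.\<close>

lemma horizontal_root_bound:
  assumes rep: "tree_rep W h p q" and n: "n \<ge> 3" and W: "W = tree_verts (T n)" and root: "h []"
    and box: "in_box W h p q a b c d"
  shows "real n \<le> (b - a) + (d - c)"
proof -
  define Q where "Q s t = {i. i < 16 * n + 1 \<and> (if s then p [] \<le> p [i, 0] else p [i, 0] \<le> p []) \<and>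
    (if t then q [] \<le> q [i, 0] else q [i, 0] \<le> q [])}" for s t
  have "{..<16 * n + 1} \<subseteq> Q True True \<union> Q True False \<union> Q False True \<union> Q False False"
    by (auto simp: Q_def)
  moreover have "finite (Q s t)" for s t
    by (simp add: Q_def)
  ultimately have "16 * n + 1 \<le> card (Q True True \<union> Q True False \<union> Q False True \<union> Q False False)"
    using card_mono[of _ "{..<16 * n + 1}"] by simp
  also have "\<dots> \<le> card (Q True True) + card (Q True False) + card (Q False True) + card (Q False False)"
    by (intro order_trans[OF card_Un_le] add_mono order_refl)
  finally have sum: "16 * n + 1 \<le> \<dots>" .
  have "\<exists>s t. 4 * n + 1 \<le> card (Q s t)"
  proof (rule ccontr)
    assume "\<not> ?thesis"
    then have "card (Q s t) < 4 * n + 1" for s t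
      by (simp add: not_le)
    from this[of True True] this[of True False] this[of False True] this[of False False] sum
    show False by linarith
  qed
  then obtain s t J where J: "J \<subseteq> Q s t" "card J = 4 * n + 1"
    using obtain_subset_with_card_n by metis
  have J16: "J \<subseteq> {..<16 * n + 1}"
    using J(1) by (auto simp: Q_def)
  \<comment> \<open>Like the root, these grandchildren are horizontal, so a reflection shifts both
    by the same amount and exactly reverses the comparison with the root.\<close>
  have h2: "h [i, 0]" if "i \<in> J" for i
  proof -
    have W: "[i, 0] \<in> W" "[i] \<in> W" "[] \<in> W"
      using mem_tree_verts_T[OF n, of i "[]"] J16 that tree_verts_prefix[of "[i]" "[0]"]
      by (auto simp: W simp del: tree_verts.simps)
    show ?thesis
      using tree_rep.nbr_orient[OF rep W(3,2)] tree_rep.nbr_orient[OF rep W(2,1)] root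
      by (auto simp: nbr_def)
  qed
  note rx = tree_rep_reflect_x[OF rep] and bx = in_box_reflect_x[OF box]
  note ry = tree_rep_reflect_y[OF rep] and by0 = in_box_reflect_y[OF box]
  note rxy = tree_rep_reflect_y[OF rx] and bxy = in_box_reflect_y[OF bx]
  show ?thesis
  proof (cases s; cases t)
    assume "s" "t"
    then show ?thesis
      using tree_rep.quadrant_bound[OF rep n W root J16 J(2) _ box] J(1) by (auto simp: Q_def)
  next
    assume "s" "\<not> t"
    then show ?thesis
      using tree_rep.quadrant_bound[OF ry n W root J16 J(2) _ by0] J(1) h2 root
      by (auto simp: Q_def)
  next
    assume "\<not> s" "t"
    then show ?thesis
      using tree_rep.quadrant_bound[OF rx n W root J16 J(2) _ bx] J(1) h2 root
      by (auto simp: Q_def)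
  next
    assume "\<not> s" "\<not> t"
    then show ?thesis
      using tree_rep.quadrant_bound[OF rxy n W root J16 J(2) _ bxy] J(1) h2 root
      by (auto simp: Q_def)
  qed
qed

section \<open>From segments in the plane to endpoint coordinates\<close>

definition unit_segment :: "bool \<Rightarrow> real \<Rightarrow> real \<Rightarrow> (real \<times> real) set" where
  "unit_segment hz x y = {x..x + of_bool hz} \<times> {y..y + of_bool (\<not> hz)}"

lemma horizontal_unit_segment_iff:
  "horizontal_unit_segment s \<longleftrightarrow> (\<exists>x y. s = unit_segment True x y)"
  by (simp add: horizontal_unit_segment_def unit_segment_def closed_segment_same_snd
      closed_segment_eq_real_ivl)

lemma vertical_unit_segment_iff:
  "vertical_unit_segment s \<longleftrightarrow> (\<exists>x y. s = unit_segment False x y)"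
  by (simp add: vertical_unit_segment_def unit_segment_def closed_segment_same_fst
      closed_segment_eq_real_ivl)

theorem theorem2:
  fixes n :: nat and H V :: "nat list set" and S :: "nat list \<Rightarrow> (real \<times> real) set"
  assumes "n \<ge> 2"
    and "unit_grid_representation (tree_verts (T n)) (tree_edges (T n)) H V S"
  shows "boundary_size (tree_verts (T n)) S \<ge> real n"
proof -
  define W where "W = tree_verts (T n)"
  define h where "h u \<longleftrightarrow> u \<in> H" for u
  note grid = assms(2)[folded W_def, unfolded unit_grid_representation_def bipartition_def]
  have HV: "H \<union> V = W" "H \<inter> V = {}"
    and bipart: "\<forall>e\<in>tree_edges (T n). \<exists>u\<in>H. \<exists>v\<in>V. e = {u, v}"
    and hor: "\<forall>u\<in>H. horizontal_unit_segment (S u)"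
    and ver: "\<forall>v\<in>V. vertical_unit_segment (S v)"
    and cross: "\<forall>u\<in>H. \<forall>v\<in>V. S u \<inter> S v \<noteq> {} \<longleftrightarrow> {u, v} \<in> tree_edges (T n)"
    using grid by simp_all
  have "\<exists>z. S u = unit_segment (h u) (fst z) (snd z)" if "u \<in> W" for u
  proof (cases "u \<in> H")
    case True
    then show ?thesis
      using hor by (simp add: h_def horizontal_unit_segment_iff)
  next
    case False
    then have "u \<in> V"
      using HV that by blast
    then show ?thesis
      using False ver by (simp add: h_def vertical_unit_segment_iff)
  qed
  then obtain z where z: "\<And>u. u \<in> W \<Longrightarrow> S u = unit_segment (h u) (fst (z u)) (snd (z u))"
    by metis
  define p q where "p u = fst (z u)" and "q u = snd (z u)" for u
  have S: "S u = unit_segment (h u) (p u) (q u)" if "u \<in> W" for u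
    using z that by (simp add: p_def q_def)
  have rep: "tree_rep W h p q"
  proof
    show "h u \<noteq> h v" if "u \<in> W" "v \<in> W" "nbr u v" for u v
    proof -
      have "{u, v} \<in> tree_edges (T n)"
        using that tree_edges_iff_nbr by (simp add: W_def)
      then obtain u' v' where "u' \<in> H" "v' \<in> V" "{u, v} = {u', v'}"
        using bipart by blast
      then show ?thesis
        using HV(2) by (auto simp: h_def doubleton_eq_iff)
    qed
    show "nbr u v \<longleftrightarrow> p u \<le> p v \<and> p v \<le> p u + 1 \<and> q v \<le> q u \<and> q u \<le> q v + 1"
      if "u \<in> W" "v \<in> W" "h u" "\<not> h v" for u v
    proof -
      have "u \<in> H" "v \<in> V"
        using that HV(1) by (auto simp: h_def)
      then have "nbr u v \<longleftrightarrow> S u \<inter> S v \<noteq> {}"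
        using that(1,2) cross tree_edges_iff_nbr[of u "T n" v] by (simp add: W_def)
      also have "\<dots> \<longleftrightarrow> p u \<le> p v \<and> p v \<le> p u + 1 \<and> q v \<le> q u \<and> q u \<le> q v + 1"
        using that by (simp add: S unit_segment_def Times_Int_Times) auto
      finally show ?thesis .
    qed
    show "[] \<in> W"
      by (simp add: W_def)
    show "x \<in> W" if "x @ y \<in> W" for x y
      using that tree_verts_prefix by (simp add: W_def)
  qed
  define A where "A = (\<Union>w\<in>W. S w)"
  define a b c d where "a = Inf (fst ` A)" "b = Sup (fst ` A)" "c = Inf (snd ` A)" "d = Sup (snd ` A)"
  have corner: "(p u, q u) \<in> A" "(p u + of_bool (h u), q u + of_bool (\<not> h u)) \<in> A" if "u \<in> W" for u
  proof -
    have "(p u, q u) \<in> S u" "(p u + of_bool (h u), q u + of_bool (\<not> h u)) \<in> S u"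
      using S[OF that] by (auto simp: unit_segment_def)
    then show "(p u, q u) \<in> A" "(p u + of_bool (h u), q u + of_bool (\<not> h u)) \<in> A"
      using that by (auto simp: A_def)
  qed
  have "finite W"
    by (simp add: W_def finite_tree_verts)
  then have "bounded A"
    unfolding A_def by (intro bounded_UN) (simp_all add: S unit_segment_def bounded_Times)
  then have bdd: "bdd_below (fst ` A)" "bdd_above (fst ` A)" "bdd_below (snd ` A)" "bdd_above (snd ` A)"
    by (simp_all add: bounded_fst bounded_snd bounded_imp_bdd_below bounded_imp_bdd_above)
  have in_range: "a \<le> x" "x \<le> b" "c \<le> y" "y \<le> d" if "(x, y) \<in> A" for x y
    using that bdd by (force simp: a_b_c_d_def intro!: cInf_lower cSup_upper)+
  have box: "in_box W h p q a b c d"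
    unfolding in_box_def using in_range corner by blast
  have "A \<noteq> {}"
    using corner[of "[]"] by (auto simp: W_def simp del: tree_verts.simps)
  moreover have "a \<le> b" "c \<le> d"
    using in_range[OF corner(1)[of "[]"]] by (auto simp: W_def simp del: tree_verts.simps)
  ultimately have "boundary_size W S = (b - a) + (d - c)"
    using \<open>bounded A\<close> unfolding boundary_size_def A_def[symmetric]
    by (simp add: bounding_box_eq semiperimeter_rectangle flip: a_b_c_d_def)
  moreover have "real n \<le> (b - a) + (d - c)"
  proof (cases "n \<ge> 3")
    case True
    show ?thesis
    proof (cases "h []")
      case True
      then show ?thesis
        using horizontal_root_bound[OF rep \<open>n \<ge> 3\<close> W_def _ box] by simp
    next
      \<comment> \<open>Exchanging the axes makes the root horizontal and leaves the semiperimeter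
        unchanged.\<close>
      case False
      then show ?thesis
        using horizontal_root_bound[OF tree_rep_swap[OF rep] \<open>n \<ge> 3\<close> W_def _ in_box_swap[OF box]]
        by simp
    qed
  next
    case False
    \<comment> \<open>For \<open>n = 2\<close> the root and one child already suffice: one is
      horizontal and the other vertical, so width and height are both at least 1.\<close>
    have "[] \<in> W" "[0] \<in> W"
      using singleton_mem_tree_verts_T[of 0 n] by (simp_all add: W_def del: tree_verts.simps)
    moreover from this have "h [] \<noteq> h [0]"
      by (intro tree_rep.nbr_orient[OF rep]) (auto simp: nbr_def)
    moreover have "n = 2"
      using False assms(1) by simp
    moreover have "a \<le> p u \<and> p u + of_bool (h u) \<le> b \<and> c \<le> q u \<and> q u + of_bool (\<not> h u) \<le> d"
      if "u \<in> W" for u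
      using box that unfolding in_box_def by blast
    from this[OF \<open>[] \<in> W\<close>] this[OF \<open>[0] \<in> W\<close>] have "2 \<le> (b - a) + (d - c)"
      using \<open>h [] \<noteq> h [0]\<close> by (cases "h []") auto
    ultimately show ?thesis
      by simp
  qed
  ultimately show ?thesis
    by (simp add: W_def)
qed

end
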